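(* Let $ABC$ be a triangle with inradius $r$, let $0<\theta<360^\circ$, put $t=\tan\frac{\theta}{4}$, and assume that every angle of $\triangle ABC$ is less than $180^\circ-\frac{\theta}{2}$. Let $\rho_a,\rho_b,\rho_c$ be the radii of the circles $\gamma_a,\gamma_b,\gamma_c$ of the general triad associated with $\triangle ABC$ and $\theta$. Then $$3r^2-2r(\rho_a+\rho_b+\rho_c)+(\rho_a\rho_b+\rho_b\rho_c+\rho_c\rho_a)=r^2t^2.$$
   Context: General triad of circles: $\omega_a$ is the circular arc of angular measure $\theta$ with endpoints $B$ and $C$ erected internally on side $BC$ (i.e. lying on the same side of line $BC$ as $A$); $\omega_b$ (on $CA$) and $\omega_c$ (on $AB$) are defined similarly with the same angular measure $\theta$. $\gamma_a$ is the circle inside $\triangle ABC$, tangent to sides $AB$ and $AC$ and externally tangent to $\omega_a$; $\gamma_b,\gamma_c$ are defined similarly. The assumption that all angles are less than $180^\circ-\theta/2$ is equivalent to the three circles lying inside the triangle. *)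

theory Defs
  imports "HOL-Complex_Analysis.Contour_Integration"
begin

(* The Euclidean plane is the type complex; angles are in radians.  A circle is given by its
   centre and radius, with point set sphere K \<rho>. *)

definition nondegenerate_triangle :: "complex \<Rightarrow> complex \<Rightarrow> complex \<Rightarrow> bool" where
  "nondegenerate_triangle A B C \<longleftrightarrow> \<not> collinear {A, B, C}"

definition angle_at :: "complex \<Rightarrow> complex \<Rightarrow> complex \<Rightarrow> real" where
  "angle_at P Q R = arccos (((Q - P) \<bullet> (R - P)) / (norm (Q - P) * norm (R - P)))"
  (* the angle QPR; the vertex is the first argument *)

definition same_side :: "complex \<Rightarrow> complex \<Rightarrow> complex \<Rightarrow> complex \<Rightarrow> bool" where
  "same_side P Q X Y \<longleftrightarrow> closed_segment X Y \<inter> affine hull {P, Q} = {}"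
  (* X and Y lie strictly on the same side of the line PQ *)

definition tangent_to_side :: "complex \<Rightarrow> real \<Rightarrow> complex \<Rightarrow> complex \<Rightarrow> bool" where
  "tangent_to_side K \<rho> P Q \<longleftrightarrow>
     (\<exists>T \<in> closed_segment P Q. sphere K \<rho> \<inter> affine hull {P, Q} = {T})"

definition inside_triangle ::
    "complex \<Rightarrow> real \<Rightarrow> complex \<Rightarrow> complex \<Rightarrow> complex \<Rightarrow> bool" where
  "inside_triangle K \<rho> A B C \<longleftrightarrow> sphere K \<rho> \<subseteq> convex hull {A, B, C}"

definition is_inradius :: "complex \<Rightarrow> complex \<Rightarrow> complex \<Rightarrow> real \<Rightarrow> bool" where
  "is_inradius A B C r \<longleftrightarrow> 0 < r \<and>
     (\<exists>I. inside_triangle I r A B C \<and>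
          tangent_to_side I r A B \<and> tangent_to_side I r B C \<and> tangent_to_side I r C A)"

(* The arc of the circle with centre Z and radius R from argument \<phi> to \<phi> + \<theta> is the
   arc of angular measure \<theta> erected on the side BC internally.  Traversed counterclockwise it
   may run from B to C or from C to B, depending on the orientation of ABC. *)
definition internal_arc ::
    "real \<Rightarrow> complex \<Rightarrow> complex \<Rightarrow> complex \<Rightarrow> complex \<Rightarrow> real \<Rightarrow> real \<Rightarrow> bool" where
  "internal_arc \<theta> A B C Z R \<phi> \<longleftrightarrow> 0 < R \<and>
     {pathstart (part_circlepath Z R \<phi> (\<phi> + \<theta>)),
      pathfinish (part_circlepath Z R \<phi> (\<phi> + \<theta>))} = {B, C} \<and>
     (\<forall>P \<in> path_image (part_circlepath Z R \<phi> (\<phi> + \<theta>)) - {B, C}. same_side B C A P)"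

(* External tangency to an arc: the two full circles are externally tangent, and their point of
   contact lies on the arc. *)
definition externally_tangent_to_arc ::
    "complex \<Rightarrow> real \<Rightarrow> complex \<Rightarrow> real \<Rightarrow> real \<Rightarrow> real \<Rightarrow> bool" where
  "externally_tangent_to_arc K \<rho> Z R \<phi> \<theta> \<longleftrightarrow>
     dist K Z = \<rho> + R \<and>
     sphere K \<rho> \<inter> path_image (part_circlepath Z R \<phi> (\<phi> + \<theta>)) \<noteq> {}"

(* \<rho> is the radius of the triad circle belonging to the first vertex A; the circles belonging to
   B and C are obtained by cyclic permutation of the vertices. *)
definition is_triad_radius ::
    "real \<Rightarrow> complex \<Rightarrow> complex \<Rightarrow> complex \<Rightarrow> real \<Rightarrow> bool" where
  "is_triad_radius \<theta> A B C \<rho> \<longleftrightarrow> 0 < \<rho> \<and>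
     (\<exists>K Z R \<phi>. internal_arc \<theta> A B C Z R \<phi> \<and>
        inside_triangle K \<rho> A B C \<and>
        tangent_to_side K \<rho> A B \<and> tangent_to_side K \<rho> A C \<and>
        externally_tangent_to_arc K \<rho> Z R \<phi> \<theta>)"

end

theory Submission
  imports Defs
begin

text \<open>
  The whole identity comes from one formula for a single circle of the triad.  If \<open>x\<close> is the length of
  the tangent from the vertex \<open>A\<close> to the incircle, so that \<open>tan (A/2) = r/x\<close>, then
  \<open>\<rho>\<^sub>a = r (1 - t r/x)\<close> (lemma \<open>triad_radius_eq\<close>).  The left-hand side of the theorem is the sum of the
  products \<open>(r - \<rho>\<^sub>a) (r - \<rho>\<^sub>b)\<close> over the three pairs of vertices.  By the formula this sum is
  \<open>t\<^sup>2 r\<^sup>4 (x + y + z) / (x y z)\<close>, and \<open>r\<^sup>2 (x + y + z) = x y z\<close> for the three tangent lengths (lemma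
  \<open>sum_tangent_lengths\<close>; it says that the products of two half-angle tangents add up to \<open>1\<close>).

  To prove the formula, let \<open>K\<close> be the centre of the triad circle.  It has distance \<open>\<rho>\<close> from the lines
  \<open>AB\<close> and \<open>AC\<close> and lies on their inner side, as the incentre \<open>I\<close> does with distance \<open>r\<close>.
  Hence \<open>K - A = (\<rho>/r) (I - A)\<close> (lemma \<open>triad_centre\<close>).  The centre \<open>Z\<close> and radius \<open>R\<close> of the arc on
  \<open>BC\<close> are known from the chord and \<open>\<theta>\<close> (lemma \<open>internal_arc_centre\<close>).
  External tangency, \<open>dist K Z = \<rho> + R\<close>, therefore becomes a quadratic equation for
  \<open>\<mu> = 1 - \<rho>/r\<close>.  In coordinates with origin \<open>I\<close> and an axis parallel to \<open>BC\<close> it factors as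
  \<open>x\<^sup>2 (\<mu> - t r/x) (\<mu> + \<nu>) = 0\<close> with \<open>\<nu> > 0\<close> (lemma \<open>triad_quadratic\<close>).  The root \<open>- \<nu>\<close> belongs to a
  circle larger than the incircle, in fact larger than the excircle opposite \<open>A\<close>; no such circle
  lies in the triangle, because clearance \<open>\<rho>\<close> from all three sides forces \<open>\<rho> \<le> r\<close>.
\<close>

section \<open>Signed area and orientation\<close>

text \<open>Twice the signed area of the triangle spanned by two vectors.\<close>

definition det2 :: "complex \<Rightarrow> complex \<Rightarrow> real" where
  "det2 v w = Re v * Im w - Im v * Re w"

text \<open>
  The sign makes \<open>orientation A B C * det2 (B - A) (X - A)\<close> nonnegative for \<open>X\<close> in the triangle, whichever
  way round its vertices are listed; divided by \<open>norm (B - A)\<close> it is the distance from \<open>AB\<close>, counted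
  positive inwards.
\<close>

definition orientation :: "complex \<Rightarrow> complex \<Rightarrow> complex \<Rightarrow> real" where
  "orientation A B C = sgn (det2 (B - A) (C - A))"

lemma det2_linear_right:
  "det2 v (of_real a * w + of_real b * w') = a * det2 v w + b * det2 v w'"
  by (simp add: det2_def algebra_simps)

text \<open>Multiplication by \<open>u\<close> is a similarity with ratio \<open>norm u\<close>, so it preserves orientation.\<close>

lemma det2_mult_left: "det2 (u * v) (u * w) = (norm u)\<^sup>2 * det2 v w"
  unfolding det2_def cmod_power2 times_complex.sel by algebra

lemma det2_cyclic: "det2 (C - B) (A - B) = det2 (B - A) (C - A)"
  by (simp add: det2_def algebra_simps)

lemma orientation_cyclic: "orientation B C A = orientation A B C"
  by (simp add: orientation_def det2_cyclic)

text \<open>The equality case of Cauchy-Schwarz, since \<open>det2\<close> accounts for the gap (Lagrange's identity).\<close>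

lemma collinear_iff_det2: "collinear {A, B, C} \<longleftrightarrow> det2 (B - A) (C - A) = 0"
proof -
  have "collinear {A, B, C} \<longleftrightarrow> collinear {0, B - A, C - A}"
    using collinear_3[of B A C] by (simp add: insert_commute)
  also have "\<dots> \<longleftrightarrow> \<bar>(B - A) \<bullet> (C - A)\<bar> = norm (B - A) * norm (C - A)"
    by (simp add: norm_cauchy_schwarz_equal)
  also have "\<dots> \<longleftrightarrow> ((B - A) \<bullet> (C - A))\<^sup>2 = (norm (B - A))\<^sup>2 * (norm (C - A))\<^sup>2"
    by (metis abs_ge_zero mult_nonneg_nonneg norm_ge_zero power2_abs power2_eq_iff_nonneg power_mult_distrib)
  also have "\<dots> \<longleftrightarrow> (det2 (B - A) (C - A))\<^sup>2 = 0"
  proof -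
    have "(norm (B - A))\<^sup>2 * (norm (C - A))\<^sup>2 = ((B - A) \<bullet> (C - A))\<^sup>2 + (det2 (B - A) (C - A))\<^sup>2"
      unfolding cmod_power2 inner_complex_def det2_def by algebra
    then show ?thesis by auto
  qed
  finally show ?thesis by simp
qed

lemma orientation_sq:
  assumes "nondegenerate_triangle A B C"
  shows "orientation A B C * orientation A B C = 1"
    and "\<bar>orientation A B C\<bar> = 1"
  using assms unfolding nondegenerate_triangle_def collinear_iff_det2 orientation_def
  by (auto simp: sgn_if)

section \<open>Circles in a triangle: distances from the sides\<close>

lemma nondegenerate_triangle_cyclic:
  "nondegenerate_triangle B C A \<longleftrightarrow> nondegenerate_triangle A B C"
  by (simp add: nondegenerate_triangle_def insert_commute)

lemma inside_triangle_cyclic: "inside_triangle K \<rho> B C A \<longleftrightarrow> inside_triangle K \<rho> A B C"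
  by (simp add: inside_triangle_def insert_commute)

lemma tangent_to_side_commute: "tangent_to_side K \<rho> P Q \<longleftrightarrow> tangent_to_side K \<rho> Q P"
  by (simp add: tangent_to_side_def insert_commute closed_segment_commute)

text \<open>
  The point of the circle that is extreme in the outward direction of \<open>AB\<close> still belongs to the
  triangle, hence to the inner half-plane of \<open>AB\<close>.
\<close>

lemma side_clearance:
  assumes "nondegenerate_triangle A B C" "inside_triangle K \<rho> A B C" "0 < \<rho>"
  shows "\<rho> * norm (B - A) \<le> orientation A B C * det2 (B - A) (K - A)"
proof -
  define \<sigma> where "\<sigma> = orientation A B C"
  have \<sigma>: "\<sigma> * \<sigma> = 1" "\<bar>\<sigma>\<bar> = 1"
    using orientation_sq[OF assms(1)] by (simp_all add: \<sigma>_def)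
  have "A \<noteq> B" using assms(1) by (auto simp: nondegenerate_triangle_def)
  then have L: "norm (B - A) > 0" by simp
  \<comment> \<open>the unit normal of \<open>AB\<close> that points inwards\<close>
  define n where "n = of_real \<sigma> * \<i> * (B - A) / of_real (norm (B - A))"
  have "norm n = 1" using L \<sigma> by (simp add: n_def norm_mult norm_divide)
  then have "K - of_real \<rho> * n \<in> sphere K \<rho>"
    using assms(3) by (simp add: dist_norm norm_mult)
  then have "K - of_real \<rho> * n \<in> convex hull {A, B, C}"
    using assms(2) by (auto simp: inside_triangle_def)
  then obtain v w where vw: "0 \<le> w" "K - of_real \<rho> * n = A + v *\<^sub>R (B - A) + w *\<^sub>R (C - A)"
    by (auto simp: convex_hull_3_alt)
  have "\<sigma> * det2 (B - A) (K - of_real \<rho> * n - A) = w * \<bar>det2 (B - A) (C - A)\<bar>"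
    unfolding vw \<sigma>_def orientation_def
    by (auto simp: det2_def sgn_if algebra_simps)
  with vw have ge: "0 \<le> \<sigma> * det2 (B - A) (K - of_real \<rho> * n - A)" by simp
  have "det2 (B - A) n = \<sigma> * ((Re (B - A))\<^sup>2 + (Im (B - A))\<^sup>2) / norm (B - A)"
    by (simp add: det2_def n_def Re_divide_of_real Im_divide_of_real power2_eq_square diff_divide_distrib algebra_simps add_divide_distrib)
  also have "\<dots> = \<sigma> * norm (B - A)"
    using L unfolding cmod_power2[symmetric] by (simp add: power2_eq_square)
  finally have "det2 (B - A) n = \<sigma> * norm (B - A)" .
  moreover have "det2 (B - A) (K - of_real \<rho> * n - A)
      = det2 (B - A) (K - A) - \<rho> * det2 (B - A) n"
    by (simp add: det2_def algebra_simps)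
  ultimately have "\<sigma> * det2 (B - A) (K - of_real \<rho> * n - A)
      = \<sigma> * det2 (B - A) (K - A) - \<rho> * norm (B - A) * (\<sigma> * \<sigma>)"
    by algebra
  then show ?thesis using ge \<sigma> by (simp add: \<sigma>_def)
qed

definition incircle :: "complex \<Rightarrow> real \<Rightarrow> complex \<Rightarrow> complex \<Rightarrow> complex \<Rightarrow> bool" where
  "incircle I r A B C \<longleftrightarrow> 0 < r \<and> inside_triangle I r A B C \<and>
     tangent_to_side I r A B \<and> tangent_to_side I r B C \<and> tangent_to_side I r C A"

lemma incircle_cyclic: "incircle I r B C A \<longleftrightarrow> incircle I r A B C"
  by (auto simp: incircle_def inside_triangle_cyclic)

lemma abs_det2_le: "\<bar>det2 v w\<bar> \<le> norm v * norm w"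
proof -
  have "(det2 v w)\<^sup>2 \<le> (norm v)\<^sup>2 * (norm w)\<^sup>2"
  proof -
    have "(norm v)\<^sup>2 * (norm w)\<^sup>2 = (v \<bullet> w)\<^sup>2 + (det2 v w)\<^sup>2"
      unfolding cmod_power2 inner_complex_def det2_def by algebra
    then show ?thesis by simp
  qed
  then show ?thesis
    by (metis abs_le_square_iff abs_of_nonneg mult_nonneg_nonneg norm_ge_zero power_mult_distrib)
qed

text \<open>
  Tangency puts a point of the line at distance \<open>\<rho>\<close> from the centre, so the distance from the line is at
  most \<open>\<rho>\<close>; the clearance gives the opposite bound, and with it the side on which the centre lies.
\<close>

lemma side_distance:
  assumes "nondegenerate_triangle A B C" "inside_triangle K \<rho> A B C" "0 < \<rho>"
    and "tangent_to_side K \<rho> A B"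
  shows "orientation A B C * det2 (B - A) (K - A) = \<rho> * norm (B - A)"
proof (rule antisym)
  obtain T where "T \<in> sphere K \<rho> \<inter> affine hull {A, B}"
    using assms(4) unfolding tangent_to_side_def by blast
  then obtain c where T: "T = A + c *\<^sub>R (B - A)" "norm (K - T) = \<rho>"
    by (auto simp: affine_hull_2_alt dist_norm)
  have "det2 (B - A) (K - A) = det2 (B - A) (K - T)"
    by (simp add: T(1) det2_def algebra_simps)
  then have "\<bar>det2 (B - A) (K - A)\<bar> \<le> \<rho> * norm (B - A)"
    using abs_det2_le[of "B - A" "K - T"] T(2) by (simp add: mult.commute)
  then have "\<bar>orientation A B C * det2 (B - A) (K - A)\<bar> \<le> \<rho> * norm (B - A)"
    by (simp add: abs_mult orientation_sq[OF assms(1)])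
  then show "orientation A B C * det2 (B - A) (K - A) \<le> \<rho> * norm (B - A)" by simp
qed (rule side_clearance[OF assms(1-3)])

lemma side_distance_incircle:
  assumes "nondegenerate_triangle A B C" "incircle I r A B C"
  shows "orientation A B C * det2 (B - A) (I - A) = r * norm (B - A)"
  using assms by (intro side_distance) (auto simp: incircle_def)

section \<open>The circle that carries the arc\<close>

text \<open>
  The signed area is continuous along the segment from \<open>X\<close> to \<open>Y\<close> and vanishes only on the line \<open>PQ\<close>.
\<close>

lemma same_side_sgn:
  assumes "P \<noteq> Q" "same_side P Q X Y"
  shows "sgn (det2 (Q - P) (X - P)) = sgn (det2 (Q - P) (Y - P))"
proof -
  define f where "f W = det2 (Q - P) (W - P)" for W
  have ne: "f W \<noteq> 0" if "W \<in> closed_segment X Y" for W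
    using assms that unfolding f_def same_side_def collinear_iff_det2[symmetric]
    by (auto simp: collinear_3_affine_hull)
  have "continuous_on (closed_segment X Y) f"
    unfolding f_def det2_def by (intro continuous_intros)
  then have conn: "connected (f ` closed_segment X Y)"
    by (intro connected_continuous_image connected_segment)
  have False if "f X < 0" "0 < f Y"
    using connectedD_interval[OF conn, of "f X" "f Y" 0] that ne by auto
  moreover have False if "f Y < 0" "0 < f X"
    using connectedD_interval[OF conn, of "f Y" "f X" 0] that ne by auto
  ultimately have "sgn (f X) = sgn (f Y)"
    using ne[of X] ne[of Y] by (cases "f X" "0 :: real" rule: linorder_cases;
        cases "f Y" "0 :: real" rule: linorder_cases) auto
  then show "sgn (det2 (Q - P) (X - P)) = sgn (det2 (Q - P) (Y - P))" by (simp add: f_def)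
qed

text \<open>
  If \<open>m\<close> is the unit vector from \<open>Z\<close> to the midpoint \<open>M\<close> of the arc, then \<open>m\<close> is perpendicular to the chord
  and the midpoint of the chord is \<open>Z + R cos (\<theta>/2) m\<close>, so that \<open>M\<close> is displaced from it by a positive
  multiple of \<open>m\<close>.  Since \<open>M\<close> is on the same side of \<open>BC\<close> as \<open>A\<close>, \<open>m\<close> is the inner unit normal of \<open>BC\<close>.  For \<open>\<theta> > \<pi>\<close> the cosine is
  negative and the centre lies on the side of \<open>A\<close>.
\<close>

lemma internal_arc_centre:
  assumes "nondegenerate_triangle A B C" "internal_arc \<theta> A B C Z R \<phi>"
    and "0 < \<theta>" "\<theta> < 2 * pi"
  shows "norm (C - B) = 2 * R * sin (\<theta> / 2)"
    and "Z = (B + C) / 2 - of_real (orientation A B C * R * cos (\<theta> / 2) / norm (C - B)) * \<i> * (C - B)"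
proof -
  define m where "m = cis (\<phi> + \<theta> / 2)"
  define M where "M = Z + of_real R * m"
  define s where "s = Z + of_real R * cis \<phi>"
  define f where "f = Z + of_real R * cis (\<phi> + \<theta>)"
  define S where "S = sin (\<theta> / 2)"
  define c where "c = cos (\<theta> / 2)"
  have R: "0 < R" and sf: "{s, f} = {B, C}"
    and side: "\<And>P. P \<in> path_image (part_circlepath Z R \<phi> (\<phi> + \<theta>)) - {B, C} \<Longrightarrow> same_side B C A P"
    using assms(2) by (auto simp: internal_arc_def s_def f_def cis_conv_exp)
  have S: "S > 0" unfolding S_def using assms(3,4) by (intro sin_gt_zero) auto
  have c: "c < 1" unfolding c_def using assms(3,4) cos_monotone_0_pi[of 0 "\<theta> / 2"] by simp
  have "cis \<phi> = m * cis (- (\<theta> / 2))" "cis (\<phi> + \<theta>) = m * cis (\<theta> / 2)"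
    by (simp_all add: m_def cis_mult add.commute)
  moreover have "cis (- (\<theta> / 2)) = of_real c - of_real S * \<i>" "cis (\<theta> / 2) = of_real c + of_real S * \<i>"
    by (simp_all add: c_def S_def complex_eq_iff)
  ultimately have s: "s = Z + of_real R * m * (of_real c - of_real S * \<i>)"
    and f: "f = Z + of_real R * m * (of_real c + of_real S * \<i>)"
    by (simp_all only: s_def f_def mult.assoc)
  have nm: "norm m = 1" by (simp add: m_def)
  have BC: "B \<noteq> C" using assms(1) by (auto simp: nondegenerate_triangle_def)
  \<comment> \<open>\<open>\<epsilon>\<close> records whether the arc runs counterclockwise from \<open>B\<close> to \<open>C\<close> or from \<open>C\<close> to \<open>B\<close>\<close>
  obtain \<epsilon> :: real where e: "\<bar>\<epsilon>\<bar> = 1" "C - B = of_real \<epsilon> * (f - s)"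
  proof (cases "B = s")
    case True
    then have "C = f" using sf BC by auto
    then show ?thesis using True that[of 1] by simp
  next
    case False
    then have "B = f" "C = s" using sf BC by auto
    then show ?thesis using that[of "-1"] by simp
  qed
  have sum: "B + C = 2 * Z + of_real (2 * R * c) * m"
  proof -
    have "B + C = s + f" using sf BC by (auto simp: doubleton_eq_iff)
    also have "s + f = 2 * Z + of_real (2 * R * c) * m" by (simp add: s f algebra_simps)
    finally show ?thesis .
  qed
  have diff: "C - B = of_real (2 * R * S * \<epsilon>) * (\<i> * m)"
    unfolding e(2) s f by (simp add: algebra_simps)
  have Z: "Z = (B + C) / 2 - of_real (R * c) * m" using sum by (simp add: field_simps)
  show L: "norm (C - B) = 2 * R * sin (\<theta> / 2)"
    unfolding diff using R S e(1) nm by (simp add: norm_mult abs_mult S_def)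
  have "M \<in> path_image (part_circlepath Z R \<phi> (\<phi> + \<theta>))"
    unfolding path_image_part_circlepath' M_def m_def
    using assms(3) by (auto simp: closed_segment_eq_real_ivl)
  moreover have detM: "det2 (C - B) (M - B) = - \<epsilon> * (2 * R\<^sup>2 * S * (1 - c))"
  proof -
    have "M - B = of_real (R * (1 - c)) * m + of_real (1/2) * (C - B)"
      by (simp add: M_def Z field_simps)
    then have "det2 (C - B) (M - B) = det2 (C - B) (of_real (R * (1 - c)) * m)"
      by (simp only: det2_linear_right) (simp add: det2_def algebra_simps)
    also have "\<dots> = 2 * R * S * \<epsilon> * (R * (1 - c)) * det2 (m * \<i>) (m * 1)"
      unfolding diff by (simp add: det2_def algebra_simps)
    also have "\<dots> = - \<epsilon> * (2 * R\<^sup>2 * S * (1 - c))"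
      unfolding det2_mult_left nm by (simp add: det2_def power2_eq_square)
    finally show ?thesis .
  qed
  \<comment> \<open>comparing the sides on which \<open>M\<close> and \<open>A\<close> lie determines the orientation from \<open>\<epsilon>\<close>\<close>
  have pos: "0 < 2 * R\<^sup>2 * S * (1 - c)" using R S c by simp
  have "M \<notin> {B, C}" using detM pos e(1) by (auto simp: det2_def)
  ultimately have "same_side B C A M" using side by simp
  then have "sgn (det2 (C - B) (A - B)) = sgn (- \<epsilon> * (2 * R\<^sup>2 * S * (1 - c)))"
    using same_side_sgn[OF BC] detM by metis
  then have "orientation A B C = sgn (- \<epsilon> * (2 * R\<^sup>2 * S * (1 - c)))"
    by (simp only: orientation_def det2_cyclic[of C B A])
  then have "orientation A B C = - \<epsilon>"
    unfolding sgn_mult[of "- \<epsilon>"] sgn_pos[OF pos] using e(1) by (auto simp: abs_if split: if_splits)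
  moreover have "of_real (\<epsilon> / norm (C - B)) * \<i> * (C - B) = - m"
  proof -
    have "\<epsilon> * \<epsilon> = 1" using e(1) by (auto simp: abs_if split: if_splits)
    moreover have "of_real (\<epsilon> / norm (C - B)) * \<i> * (C - B)
       = of_real (\<epsilon> * \<epsilon>) * of_real ((2 * R * S) / norm (C - B)) * (\<i> * \<i> * m)"
      by (subst (2) diff) (simp add: field_simps)
    ultimately show ?thesis using L R S unfolding S_def by simp
  qed
  then have m: "m = - (of_real (\<epsilon> / norm (C - B)) * \<i> * (C - B))" by simp
  have "of_real (- \<epsilon> * R * c / norm (C - B)) * \<i> * (C - B) = of_real (R * c) * m"
    by (subst m) simp
  ultimately show "Z = (B + C) / 2 - of_real (orientation A B C * R * cos (\<theta> / 2) / norm (C - B)) * \<i> * (C - B)"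
    using Z by (simp add: c_def)
qed

section \<open>Coordinates centred at the incentre\<close>

text \<open>
  Let \<open>BC\<close> be horizontal, with the incentre at height \<open>r\<close> above it and \<open>y\<close>, \<open>z\<close> the signed horizontal
  distances from the incentre to \<open>B\<close> and \<open>C\<close>; let \<open>A\<close> be at height \<open>q\<close> and horizontal offset \<open>p\<close> from the incentre.
  The two equations say that the incentre has distance \<open>r\<close> from \<open>AB\<close> and \<open>AC\<close>.  Squared, each becomes
  linear in \<open>p\<close>, since a factor \<open>q\<close> cancels, and the two determine the apex.
\<close>

lemma apex_coordinates:
  fixes y z r p q :: real
  assumes "0 < r" "0 < q"
    and l: "y * q - r * (p + y) = r * sqrt ((p + y)\<^sup>2 + q\<^sup>2)"
    and m: "z * q - r * (z - p) = r * sqrt ((z - p)\<^sup>2 + q\<^sup>2)"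
  shows "0 < y" "0 < z" "r\<^sup>2 < y * z"
    and "p = r\<^sup>2 * (y - z) / (y * z - r\<^sup>2)" and "q = 2 * r * y * z / (y * z - r\<^sup>2)"
proof -
  have pos: "0 < y" and eq: "q * (y\<^sup>2 - r\<^sup>2) = 2 * (p + y) * r * y"
    if l: "y * q - r * (p + y) = r * sqrt ((p + y)\<^sup>2 + q\<^sup>2)" for y p
  proof -
    \<comment> \<open>the unsquared equation is needed for the sign of \<open>y\<close>\<close>
    have "\<bar>p + y\<bar> < sqrt ((p + y)\<^sup>2 + q\<^sup>2)"
      using assms by (intro real_less_rsqrt) auto
    then have "- (p + y) < sqrt ((p + y)\<^sup>2 + q\<^sup>2)" by linarith
    then have "r * - (p + y) < y * q - r * (p + y)" unfolding l using assms(1) by simp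
    then have "0 < y * q" by (simp add: algebra_simps)
    then show "0 < y" using assms(2) by (simp add: zero_less_mult_iff)
    have "(y * q - r * (p + y))\<^sup>2 = r\<^sup>2 * ((p + y)\<^sup>2 + q\<^sup>2)"
      unfolding l by (simp add: power_mult_distrib)
    then have "q * (q * (y\<^sup>2 - r\<^sup>2)) = q * (2 * (p + y) * r * y)" by algebra
    then show "q * (y\<^sup>2 - r\<^sup>2) = 2 * (p + y) * r * y" using assms(2) by simp
  qed
  have m': "z * q - r * (-p + z) = r * sqrt ((-p + z)\<^sup>2 + q\<^sup>2)" using m by simp
  show y: "0 < y" and z: "0 < z" using pos[OF l] pos[OF m'] by auto
  note ey = eq[OF l] and ez = eq[OF m']
  have "(y + z) * (q * (y * z - r\<^sup>2)) = (y + z) * (2 * r * y * z)"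
    using ey ez by algebra
  then have q: "q * (y * z - r\<^sup>2) = 2 * r * y * z" using y z by simp
  then have "0 < q * (y * z - r\<^sup>2)" using y z assms by simp
  then show D: "r\<^sup>2 < y * z" using assms(2) by (simp add: zero_less_mult_iff)
  then show "q = 2 * r * y * z / (y * z - r\<^sup>2)" using q by (simp add: field_simps)
  have "(2 * r * y) * (p * (y * z - r\<^sup>2)) = (2 * r * y) * (r\<^sup>2 * (y - z))"
    using ey q by algebra
  then have "p * (y * z - r\<^sup>2) = r\<^sup>2 * (y - z)" using y assms by simp
  then show "p = r\<^sup>2 * (y - z) / (y * z - r\<^sup>2)" using D by (simp add: field_simps)
qed

text \<open>
  The rotation \<open>u\<close> makes \<open>BC\<close> horizontal, and the factor \<open>\<sigma>\<close> reflects the triangle if necessary so that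
  \<open>A\<close> lies above \<open>BC\<close>.  All vertices are rational functions of \<open>r\<close> and the tangent lengths \<open>y\<close>, \<open>z\<close>
  from \<open>B\<close> and \<open>C\<close>.
\<close>

lemma incircle_frame:
  assumes "nondegenerate_triangle A B C" "incircle I r A B C"
  defines "\<sigma> \<equiv> orientation A B C"
  obtains u :: complex and y z D :: real
  where "norm u = 1" "0 < y" "0 < z" "0 < D" "D = y * z - r\<^sup>2"
    and "A = I + u * Complex (r\<^sup>2 * (y - z) / D) (\<sigma> * (r * (y * z + r\<^sup>2) / D))"
    and "B = I + u * Complex (- y) (- \<sigma> * r)"
    and "C = I + u * Complex z (- \<sigma> * r)"
proof -
  have \<sigma>: "\<sigma> * \<sigma> = 1" "\<sigma> = 1 \<or> \<sigma> = -1"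
    using orientation_sq[OF assms(1)] by (auto simp: \<sigma>_def abs_if split: if_splits)
  have r: "0 < r" using assms(2) by (simp add: incircle_def)
  have nd: "nondegenerate_triangle B C A" "nondegenerate_triangle C A B"
    using assms(1) nondegenerate_triangle_cyclic by blast+
  have ic: "incircle I r B C A" "incircle I r C A B"
    using assms(2) incircle_cyclic by blast+
  have ori: "orientation B C A = \<sigma>" "orientation C A B = \<sigma>"
    by (simp_all add: \<sigma>_def orientation_cyclic)
  have "B \<noteq> C" using assms(1) by (auto simp: nondegenerate_triangle_def)
  define L where "L = norm (C - B)"
  have L: "0 < L" using \<open>B \<noteq> C\<close> by (simp add: L_def)
  define u where "u = (C - B) / of_real L"
  have u: "norm u = 1" using L by (simp add: u_def norm_divide) (simp add: L_def)
  then have [simp]: "u \<noteq> 0" by auto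
  define p where "p = Re ((A - I) / u)"
  \<comment> \<open>the height of \<open>A\<close> above \<open>BC\<close>, while \<open>p\<close> and the coordinates in the conclusion are relative to \<open>I\<close>\<close>
  define q where "q = r + \<sigma> * Im ((A - I) / u)"
  define y where "y = - Re ((B - I) / u)"
  define z where "z = L - y"
  have CB: "C - B = u * Complex L 0" using L by (simp add: u_def complex_of_real_def[symmetric])
  have B0: "B = I + u * Complex (- y) (Im ((B - I) / u))"
    by (simp add: y_def)
  have "\<sigma> * det2 (C - B) (I - B) = r * L"
    using side_distance_incircle[OF nd(1) ic(1)] by (simp add: ori L_def)
  also have "I - B = u * Complex y (- Im ((B - I) / u))"
    by (subst B0) (simp add: complex_eq_iff)
  also have "det2 (C - B) \<dots> = - L * Im ((B - I) / u)"
    unfolding CB det2_mult_left u by (simp add: det2_def)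
  finally have "\<sigma> * (- L * Im ((B - I) / u)) = r * L" .
  then have "L * (\<sigma> * Im ((B - I) / u)) = L * (- r)" by (simp add: algebra_simps)
  then have "\<sigma> * Im ((B - I) / u) = - r" using L by (simp only: mult_cancel_left) auto
  then have "Im ((B - I) / u) = - \<sigma> * r" using \<sigma>(2) by auto
  then have B: "B = I + u * Complex (- y) (- \<sigma> * r)" using B0 by simp
  have "C = B + u * Complex L 0" using CB by (simp add: algebra_simps)
  then have C: "C = I + u * Complex z (- \<sigma> * r)"
    unfolding B by (simp add: z_def complex_eq_iff algebra_simps)
  have "Im ((A - I) / u) = \<sigma> * (q - r)" by (simp add: q_def \<sigma> mult.assoc[symmetric])
  then have "(A - I) / u = Complex p (\<sigma> * (q - r))" by (simp add: p_def complex_eq_iff)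
  then have A: "A = I + u * Complex p (\<sigma> * (q - r))" by (simp add: field_simps)
  have BA: "B - A = u * Complex (- (p + y)) (- \<sigma> * q)"
    unfolding A B by (simp add: complex_eq_iff algebra_simps)
  have AC: "A - C = u * Complex (- (z - p)) (\<sigma> * q)"
    unfolding A C by (simp add: complex_eq_iff algebra_simps)
  have norms: "norm (B - A) = sqrt ((p + y)\<^sup>2 + q\<^sup>2)" "norm (A - C) = sqrt ((z - p)\<^sup>2 + q\<^sup>2)"
    unfolding BA AC norm_mult u using \<sigma>(2) by (auto simp: cmod_def power2_eq_square algebra_simps)
  have IA: "I - A = u * Complex (- p) (- \<sigma> * (q - r))"
    unfolding A by (simp add: complex_eq_iff algebra_simps)
  have IC: "I - C = u * Complex (- z) (\<sigma> * r)"
    unfolding C by (simp add: complex_eq_iff algebra_simps)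
  have AB': "A - B = u * Complex (p + y) (\<sigma> * q)"
    unfolding A B by (simp add: complex_eq_iff algebra_simps)
  have "0 < \<sigma> * det2 (C - B) (A - B)"
    using \<sigma> unfolding \<sigma>_def orientation_def det2_cyclic by (auto simp: sgn_if)
  also have "\<sigma> * det2 (C - B) (A - B) = L * q"
    unfolding CB AB' det2_mult_left u using \<sigma>(2) by (auto simp: det2_def)
  finally have q: "0 < q" using L by (simp add: zero_less_mult_iff)
  have "\<sigma> * det2 (B - A) (I - A) = y * q - r * (p + y)"
    unfolding BA IA det2_mult_left u using \<sigma>(2) by (auto simp: det2_def algebra_simps)
  then have 1: "y * q - r * (p + y) = r * sqrt ((p + y)\<^sup>2 + q\<^sup>2)"
    using side_distance_incircle[OF assms(1,2)] norms by (simp add: \<sigma>_def)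
  have "\<sigma> * det2 (A - C) (I - C) = z * q - r * (z - p)"
    unfolding AC IC det2_mult_left u using \<sigma>(2) by (auto simp: det2_def algebra_simps)
  then have 2: "z * q - r * (z - p) = r * sqrt ((z - p)\<^sup>2 + q\<^sup>2)"
    using side_distance_incircle[OF nd(2) ic(2)] norms by (simp add: ori)
  note ac = apex_coordinates[OF r q 1 2]
  define D where "D = y * z - r\<^sup>2"
  have D: "0 < D" using ac(3) by (simp add: D_def)
  have "q - r = r * (y * z + r\<^sup>2) / D"
    unfolding ac(5) D_def[symmetric] using D by (simp add: field_simps) (simp add: D_def power2_eq_square algebra_simps)
  then have "A = I + u * Complex (r\<^sup>2 * (y - z) / D) (\<sigma> * (r * (y * z + r\<^sup>2) / D))"
    using A ac(4) by (simp add: D_def)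
  then show thesis using that[OF u ac(1,2) D D_def _ B C] by simp
qed

definition tangent_length :: "complex \<Rightarrow> real \<Rightarrow> complex \<Rightarrow> real" where
  "tangent_length I r P = sqrt ((dist P I)\<^sup>2 - r\<^sup>2)"

text \<open>
  The hypotheses are the conclusions of \<open>incircle_frame\<close>.  The value at \<open>A\<close> is
  \<open>r\<^sup>2 (x + y + z) = x y z\<close> solved for \<open>x\<close>.
\<close>

lemma tangent_lengths:
  assumes "norm u = 1" "0 < y" "0 < z" "0 < r" "0 < D" "D = y * z - r\<^sup>2" "\<bar>\<sigma>\<bar> = 1"
    and "A = I + u * Complex (r\<^sup>2 * (y - z) / D) (\<sigma> * (r * (y * z + r\<^sup>2) / D))"
    and "B = I + u * Complex (- y) (- \<sigma> * r)"
    and "C = I + u * Complex z (- \<sigma> * r)"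
  shows "tangent_length I r A = r\<^sup>2 * (y + z) / D"
    and "tangent_length I r B = y" and "tangent_length I r C = z"
proof -
  have s: "(\<sigma> * v)\<^sup>2 = v\<^sup>2" "(- \<sigma> * v)\<^sup>2 = v\<^sup>2" for v
    using assms(7) by (auto simp: abs_if power_mult_distrib split: if_splits)
  have d: "(dist (I + u * Complex v w) I)\<^sup>2 = v\<^sup>2 + w\<^sup>2" for v w
    using assms(1) by (simp add: dist_norm norm_mult cmod_power2)
  show "tangent_length I r B = y" "tangent_length I r C = z"
    unfolding tangent_length_def assms(9,10) d s using assms(2,3) by simp_all
  have "(r\<^sup>2 * (y - z) / D)\<^sup>2 + (r * (y * z + r\<^sup>2) / D)\<^sup>2 - r\<^sup>2 = (r\<^sup>2 * (y + z) / D)\<^sup>2"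
    using assms(5) by (simp add: field_simps) (use assms(6) in algebra)
  then show "tangent_length I r A = r\<^sup>2 * (y + z) / D"
    unfolding tangent_length_def assms(8) d s using assms(2-5) by simp
qed

text \<open>With \<open>x y z\<close> and \<open>x + y + z\<close> interpreted by Heron's formula, both sides of the equation are the area times \<open>r\<close>.\<close>

lemma sum_tangent_lengths:
  assumes "nondegenerate_triangle A B C" "incircle I r A B C"
  defines "\<tau> \<equiv> tangent_length I r"
  shows "0 < \<tau> A" "0 < \<tau> B" "0 < \<tau> C" "r\<^sup>2 * (\<tau> A + \<tau> B + \<tau> C) = \<tau> A * \<tau> B * \<tau> C"
proof -
  define \<sigma> where "\<sigma> = orientation A B C"
  have \<sigma>: "\<bar>\<sigma>\<bar> = 1" using orientation_sq[OF assms(1)] by (simp add: \<sigma>_def)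
  have r: "0 < r" using assms(2) by (simp add: incircle_def)
  obtain u y z D where u: "norm u = 1" and yz: "0 < y" "0 < z" and D: "0 < D" "D = y * z - r\<^sup>2"
    and A: "A = I + u * Complex (r\<^sup>2 * (y - z) / D) (\<sigma> * (r * (y * z + r\<^sup>2) / D))"
    and B: "B = I + u * Complex (- y) (- \<sigma> * r)"
    and C: "C = I + u * Complex z (- \<sigma> * r)"
    using incircle_frame[OF assms(1,2)] unfolding \<sigma>_def by metis
  note \<tau> = tangent_lengths[OF u yz r D \<sigma> A B C, folded \<tau>_def]
  show "0 < \<tau> A" "0 < \<tau> B" "0 < \<tau> C" unfolding \<tau> using yz r D(1) by simp_all
  have "\<tau> A * D = r\<^sup>2 * (y + z)" unfolding \<tau> using D(1) by simp
  then show "r\<^sup>2 * (\<tau> A + \<tau> B + \<tau> C) = \<tau> A * \<tau> B * \<tau> C"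
    unfolding D(2) \<tau>(2,3) by algebra
qed

section \<open>The radius of a triad circle\<close>

text \<open>
  The last hypothesis is \<open>dist K Z = \<rho> + R\<close> in the coordinates of \<open>incircle_frame\<close>, with \<open>\<rho> = r (1 - \<mu>)\<close>
  and \<open>h = R cos (\<theta>/2)\<close> the signed distance of \<open>Z\<close> below \<open>BC\<close>.  The right-hand side is \<open>t r\<close> divided by
  the tangent length from \<open>A\<close>.
\<close>

lemma triad_quadratic:
  fixes y z r t \<mu> :: real
  assumes "0 < y" "0 < z" "0 < r" "0 < t" "0 \<le> \<mu>" "0 < D" "D = y * z - r\<^sup>2"
    and "R = (y + z) * (1 + t\<^sup>2) / (4 * t)" and "h = (y + z) * (1 - t\<^sup>2) / (4 * t)"
    and "(\<mu> * (r\<^sup>2 * (y - z) / D) - (z - y) / 2)\<^sup>2 + (\<mu> * (r * (y * z + r\<^sup>2) / D) + r + h)\<^sup>2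
           = (r * (1 - \<mu>) + R)\<^sup>2"
  shows "\<mu> = t * r / (r\<^sup>2 * (y + z) / D)"
proof -
  define x where "x = r\<^sup>2 * (y + z) / D"
  define p where "p = r\<^sup>2 * (y - z) / D"
  define s where "s = r * (y * z + r\<^sup>2) / D"
  \<comment> \<open>the rejected root \<open>\<mu> = - \<nu>\<close> is the radius \<open>r\<^sub>a (1 + r / (x t))\<close>, where \<open>r\<^sub>a = y z / r\<close> is the exradius at \<open>A\<close>\<close>
  define \<nu> where "\<nu> = y * z / r\<^sup>2 * (1 + r / (x * t)) - 1"
  have x: "0 < x" using assms by (simp add: x_def)
  have d: "x * D = r\<^sup>2 * (y + z)"
    using assms(6) by (simp add: x_def)
  have "1 < y * z / r\<^sup>2" using assms(3,6,7) by (simp add: field_simps)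
  moreover have "1 < 1 + r / (x * t)" using x assms by simp
  ultimately have \<nu>: "0 < \<nu>" unfolding \<nu>_def
    by (smt (verit) mult_less_cancel_left1)
  have Rh: "R - h = (y + z) * t / 2" "R + h = (y + z) / (2 * t)"
    using assms(4) by (simp_all add: assms(8,9) field_simps power2_eq_square)
  have x2: "x\<^sup>2 = p\<^sup>2 + s\<^sup>2 - r\<^sup>2"
    using assms(6) unfolding x_def p_def s_def by (simp add: field_simps) (use assms(7) in algebra)
  \<comment> \<open>Vieta: the factored quadratic has the right linear and constant coefficients\<close>
  have lin: "x\<^sup>2 * (\<nu> - t * r / x) = p * (y - z) + 2 * s * (r + h) + 2 * r * (r + R)"
  proof -
    have sr: "s + r = 2 * r * y * z / D" "s - r = 2 * r ^ 3 / D"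
      using assms(6) unfolding s_def
      by (simp_all add: field_simps) (use assms(7) in algebra)+
    have "p * (y - z) + 2 * s * (r + h) + 2 * r * (r + R)
        = p * (y - z) + 2 * r * (s + r) + (s + r) * (R + h) - (s - r) * (R - h)"
      by algebra
    also have "p * (y - z) + 2 * r * (s + r) = x * (y + z)"
      unfolding sr p_def x_def using assms(6)
      by (simp add: field_simps power2_eq_square)
    also have "(s + r) * (R + h) = x * (y * z / (r * t))"
      unfolding sr Rh x_def using assms(3,4,6) by (simp add: field_simps power2_eq_square)
    also have "(s - r) * (R - h) = x * t * r"
      unfolding sr Rh x_def using assms(3,4,6) by (simp add: field_simps power2_eq_square power3_eq_cube)
    also have "x * (y + z) = x\<^sup>2 * D / r\<^sup>2"
    proof -
      have "x\<^sup>2 * D = r\<^sup>2 * (x * (y + z))" using d by algebra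
      then show ?thesis using assms(3) by simp
    qed
    also have "x\<^sup>2 * D / r\<^sup>2 + x * (y * z / (r * t)) - x * t * r = x\<^sup>2 * (\<nu> - t * r / x)"
      unfolding \<nu>_def assms(7) using x assms(3,4) by (simp add: field_simps power2_eq_square)
    finally show ?thesis ..
  qed
  have const: "x\<^sup>2 * (t * r / x) * \<nu> = y * z + r * (y + z) * t"
  proof -
    have "x\<^sup>2 * (t * r / x) * \<nu> = y * z + t * (x * D) / r"
      unfolding \<nu>_def assms(7) using x assms(3,4) by (simp add: field_simps power2_eq_square)
    also have "t * (x * D) / r = r * (y + z) * t"
      unfolding d using assms(3) by (simp add: power2_eq_square)
    finally show ?thesis .
  qed
  have "x\<^sup>2 * ((\<mu> - t * r / x) * (\<mu> + \<nu>))
      = x\<^sup>2 * \<mu>\<^sup>2 + \<mu> * (x\<^sup>2 * (\<nu> - t * r / x)) - x\<^sup>2 * (t * r / x) * \<nu>"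
    by (simp only: algebra_simps power2_eq_square)
  also have "\<dots> = (\<mu> * p - (z - y) / 2)\<^sup>2 + (\<mu> * s + r + h)\<^sup>2 - (r * (1 - \<mu>) + R)\<^sup>2"
  proof -
    have "(r + h)\<^sup>2 - (r + R)\<^sup>2 = - 2 * r * (R - h) - (R - h) * (R + h)" by algebra
    also have "\<dots> = - r * (y + z) * t - (y + z)\<^sup>2 / 4"
      unfolding Rh using assms(4) by (simp add: power2_eq_square)
    finally show ?thesis unfolding lin const unfolding x2 by (simp add: power2_eq_square field_simps)
  qed
  also have "\<dots> = 0" using assms(10) by (simp add: p_def s_def)
  finally have "\<mu> = t * r / x \<or> \<mu> + \<nu> = 0" using x by auto
  then show ?thesis using \<nu> assms(5) by (auto simp: x_def)
qed
lemma det2_eq_0_imp: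
  assumes "det2 v w = 0" "det2 v' w = 0" "det2 v v' \<noteq> 0"
  shows "w = 0"
proof -
  have "Re w * det2 v v' = 0" "Im w * det2 v v' = 0"
    using assms(1,2) unfolding det2_def by algebra+
  then show ?thesis using assms(3) by (simp add: complex_eq_iff)
qed

text \<open>
  The homothety with centre \<open>A\<close> and ratio \<open>\<rho>/r\<close> takes the incentre to \<open>K\<close>, because the distances from
  \<open>AB\<close> and \<open>AC\<close> determine a point.  The distance of \<open>K\<close> from the third side is the
  combination of the altitude and \<open>r\<close> with weights \<open>1 - \<rho>/r\<close> and \<open>\<rho>/r\<close>; it is at least \<open>\<rho>\<close> only if \<open>\<rho> \<le> r\<close>.
\<close>

lemma triad_centre:
  assumes "nondegenerate_triangle A B C" "incircle I r A B C"
    and "0 < \<rho>" "inside_triangle K \<rho> A B C" "tangent_to_side K \<rho> A B" "tangent_to_side K \<rho> A C"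
  shows "K - A = of_real (\<rho> / r) * (I - A)" and "\<rho> \<le> r"
proof -
  define \<sigma> where "\<sigma> = orientation A B C"
  have \<sigma>: "\<sigma> \<noteq> 0" using orientation_sq[OF assms(1)] by (auto simp: \<sigma>_def)
  have r: "0 < r" using assms(2) by (simp add: incircle_def)
  have nd: "nondegenerate_triangle B C A" "nondegenerate_triangle C A B"
    using assms(1) nondegenerate_triangle_cyclic by blast+
  have ic: "incircle I r B C A" "incircle I r C A B"
    using assms(2) incircle_cyclic by blast+
  have inside: "inside_triangle K \<rho> B C A" "inside_triangle K \<rho> C A B"
    using assms(4) inside_triangle_cyclic by blast+
  have ori: "orientation B C A = \<sigma>" "orientation C A B = \<sigma>"
    by (simp_all add: \<sigma>_def orientation_cyclic)
  define w where "w = of_real r * (K - A) - of_real \<rho> * (I - A)"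
  have bilinear: "det2 (B - A) w = r * det2 (B - A) (K - A) - \<rho> * det2 (B - A) (I - A)"
    "det2 (A - C) w = r * det2 (A - C) (K - C) - \<rho> * det2 (A - C) (I - C)
       - (r - \<rho>) * det2 (A - C) (A - C)"
    by (simp_all add: w_def det2_def algebra_simps)
  have "\<sigma> * det2 (B - A) w = 0"
    using side_distance[OF assms(1,4,3,5)] side_distance_incircle[OF assms(1,2)]
    unfolding bilinear \<sigma>_def[symmetric] by algebra
  moreover have "\<sigma> * det2 (A - C) w = 0"
  proof -
    have "tangent_to_side K \<rho> C A" using assms(6) tangent_to_side_commute by blast
    from side_distance[OF nd(2) inside(2) assms(3) this] side_distance_incircle[OF nd(2) ic(2)]
    moreover have "det2 (A - C) (A - C) = 0" by (simp add: det2_def)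
    ultimately show ?thesis unfolding bilinear ori by algebra
  qed
  moreover have "det2 (B - A) (A - C) \<noteq> 0"
  proof -
    have "det2 (B - A) (A - C) = - det2 (B - A) (C - A)" by (simp add: det2_def algebra_simps)
    then show ?thesis
      using assms(1) by (simp add: nondegenerate_triangle_def collinear_iff_det2)
  qed
  ultimately have "w = 0" using \<sigma> det2_eq_0_imp by auto
  then show K: "K - A = of_real (\<rho> / r) * (I - A)" using r by (simp add: w_def field_simps)
  \<comment> \<open>the altitude from \<open>A\<close>, multiplied by the length of \<open>BC\<close>\<close>
  define H where "H = \<sigma> * det2 (C - B) (A - B)"
  have H: "0 < H"
    using \<sigma> unfolding H_def \<sigma>_def orientation_def det2_cyclic by (auto simp: sgn_if)
  have "K - B = of_real (1 - \<rho> / r) * (A - B) + of_real (\<rho> / r) * (I - B)"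
    using K unfolding of_real_diff of_real_1 by algebra
  then have "\<sigma> * det2 (C - B) (K - B) = (1 - \<rho> / r) * H + \<rho> / r * (\<sigma> * det2 (C - B) (I - B))"
    unfolding H_def by (simp only: det2_linear_right) (simp add: algebra_simps)
  also have "\<sigma> * det2 (C - B) (I - B) = r * norm (C - B)"
    using side_distance_incircle[OF nd(1) ic(1)] ori by simp
  finally have "0 \<le> (1 - \<rho> / r) * H"
    using side_clearance[OF nd(1) inside(1) assms(3)] ori r by simp
  then show "\<rho> \<le> r" using H r by (simp add: zero_le_mult_iff)
qed

text \<open>
  The half-angle formulas turn the data \<open>R\<close> and \<open>R cos (\<theta>/2)\<close> of the arc into rational functions of
  \<open>t = tan (\<theta>/4)\<close>, after which \<open>triad_quadratic\<close> applies.
\<close>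

lemma triad_radius_eq:
  assumes "nondegenerate_triangle A B C" "incircle I r A B C"
    and "0 < \<theta>" "\<theta> < 2 * pi" "is_triad_radius \<theta> A B C \<rho>"
  shows "\<rho> = r - tan (\<theta> / 4) * r\<^sup>2 / tangent_length I r A"
proof -
  define \<sigma> where "\<sigma> = orientation A B C"
  have \<sigma>: "\<bar>\<sigma>\<bar> = 1" using orientation_sq[OF assms(1)] by (simp add: \<sigma>_def)
  have r: "0 < r" using assms(2) by (simp add: incircle_def)
  obtain K Z R \<phi> where \<rho>: "0 < \<rho>" and arc: "internal_arc \<theta> A B C Z R \<phi>"
    and K: "inside_triangle K \<rho> A B C" "tangent_to_side K \<rho> A B" "tangent_to_side K \<rho> A C"
    and tang: "dist K Z = \<rho> + R"
    using assms(5) by (auto simp: is_triad_radius_def externally_tangent_to_arc_def)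
  obtain u y z D where u: "norm u = 1" and yz: "0 < y" "0 < z" and D: "0 < D" "D = y * z - r\<^sup>2"
    and A: "A = I + u * Complex (r\<^sup>2 * (y - z) / D) (\<sigma> * (r * (y * z + r\<^sup>2) / D))"
    and B: "B = I + u * Complex (- y) (- \<sigma> * r)"
    and C: "C = I + u * Complex z (- \<sigma> * r)"
    using incircle_frame[OF assms(1,2)] unfolding \<sigma>_def by metis
  define p where "p = r\<^sup>2 * (y - z) / D"
  define s where "s = r * (y * z + r\<^sup>2) / D"
  define \<mu> where "\<mu> = 1 - \<rho> / r"
  define h where "h = R * cos (\<theta> / 2)"
  define t where "t = tan (\<theta> / 4)"
  have \<mu>: "0 \<le> \<mu>" "\<rho> = r * (1 - \<mu>)"
    using triad_centre(2)[OF assms(1,2) \<rho> K] r by (simp_all add: \<mu>_def)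
  have CB: "C - B = u * of_real (y + z)"
    unfolding B C by (simp add: complex_eq_iff algebra_simps)
  have L: "norm (C - B) = y + z" unfolding CB norm_mult norm_of_real using u yz by simp
  have chord: "y + z = 2 * R * sin (\<theta> / 2)"
    using internal_arc_centre(1)[OF assms(1) arc assms(3,4)] L by simp
  have t: "0 < t" and Rt: "R = (y + z) * (1 + t\<^sup>2) / (4 * t)" and ht: "h = (y + z) * (1 - t\<^sup>2) / (4 * t)"
  proof -
    define S where "S = sin (\<theta> / 4)"
    define c where "c = cos (\<theta> / 4)"
    have S: "0 < S" unfolding S_def using assms(3,4) by (intro sin_gt_zero) auto
    have c: "0 < c" unfolding c_def using assms(3,4) by (intro cos_gt_zero) auto
    have Sc: "S\<^sup>2 + c\<^sup>2 = 1" by (simp add: S_def c_def)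
    have t': "t = S / c" by (simp add: t_def tan_def S_def c_def)
    then show "0 < t" using S c by simp
    have dbl: "sin (\<theta> / 2) = 2 * S * c" "cos (\<theta> / 2) = c\<^sup>2 - S\<^sup>2"
      using sin_double[of "\<theta> / 4"] cos_double[of "\<theta> / 4"] by (simp_all add: S_def c_def)
    have "(y + z) / (4 * t) = R * c\<^sup>2"
      unfolding chord dbl t' using S c by (simp add: field_simps power2_eq_square)
    moreover have "c\<^sup>2 * (1 + t\<^sup>2) = 1" "c\<^sup>2 * (1 - t\<^sup>2) = c\<^sup>2 - S\<^sup>2"
      unfolding t' using c Sc by (simp_all add: field_simps)
    ultimately have "(y + z) / (4 * t) * (1 + t\<^sup>2) = R" "(y + z) / (4 * t) * (1 - t\<^sup>2) = h"
      unfolding h_def dbl by simp_all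
    then show "R = (y + z) * (1 + t\<^sup>2) / (4 * t)" "h = (y + z) * (1 - t\<^sup>2) / (4 * t)" by simp_all
  qed
  have "K = I + of_real \<mu> * (A - I)"
    using triad_centre(1)[OF assms(1,2) \<rho> K] unfolding \<mu>_def of_real_diff of_real_1 by algebra
  then have K: "K = I + u * Complex (\<mu> * p) (\<sigma> * (\<mu> * s))"
    unfolding A p_def[symmetric] s_def[symmetric] by (simp add: complex_eq_iff algebra_simps)
  have "Z = (B + C) / 2 - of_real (\<sigma> * h / (y + z)) * \<i> * (C - B)"
    using internal_arc_centre(2)[OF assms(1) arc assms(3,4)]
    unfolding L \<sigma>_def[symmetric] h_def by (simp add: mult.assoc)
  also have "of_real (\<sigma> * h / (y + z)) * \<i> * (C - B) = u * Complex 0 (\<sigma> * h)"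
    unfolding CB using yz by (simp add: complex_eq_iff field_simps)
  also have "(B + C) / 2 - u * Complex 0 (\<sigma> * h) = I + u * Complex ((z - y) / 2) (- \<sigma> * (r + h))"
    unfolding B C by (simp add: complex_eq_iff field_simps)
  finally have "K - Z = u * Complex (\<mu> * p - (z - y) / 2) (\<sigma> * (\<mu> * s + r + h))"
    unfolding K by (simp add: complex_eq_iff algebra_simps)
  then have "(dist K Z)\<^sup>2 = (\<mu> * p - (z - y) / 2)\<^sup>2 + (\<mu> * s + r + h)\<^sup>2"
    using u \<sigma> by (auto simp: dist_norm norm_mult cmod_power2 power_mult_distrib abs_if split: if_splits)
  then have "(\<mu> * p - (z - y) / 2)\<^sup>2 + (\<mu> * s + r + h)\<^sup>2 = (r * (1 - \<mu>) + R)\<^sup>2"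
    unfolding tang \<mu>(2) by simp
  then have "\<mu> = t * r / (r\<^sup>2 * (y + z) / D)"
    using triad_quadratic[OF yz r t \<mu>(1) D Rt ht] by (simp add: p_def s_def)
  also have "r\<^sup>2 * (y + z) / D = tangent_length I r A"
    using tangent_lengths(1)[OF u yz r D \<sigma> A B C] by simp
  finally show ?thesis unfolding \<mu>(2) t_def by (simp add: power2_eq_square algebra_simps)
qed

theorem theorem7p6:
  fixes A B C :: complex and r \<theta> t \<rho>\<^sub>a \<rho>\<^sub>b \<rho>\<^sub>c :: real
  assumes "nondegenerate_triangle A B C"
    and "is_inradius A B C r"
    and "0 < \<theta>" and "\<theta> < 2 * pi"
    and "t = tan (\<theta> / 4)"
    and "angle_at A B C < pi - \<theta> / 2"
    and "angle_at B C A < pi - \<theta> / 2"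
    and "angle_at C A B < pi - \<theta> / 2"
    and "is_triad_radius \<theta> A B C \<rho>\<^sub>a"
    and "is_triad_radius \<theta> B C A \<rho>\<^sub>b"
    and "is_triad_radius \<theta> C A B \<rho>\<^sub>c"
  shows "3 * r\<^sup>2 - 2 * r * (\<rho>\<^sub>a + \<rho>\<^sub>b + \<rho>\<^sub>c) + (\<rho>\<^sub>a * \<rho>\<^sub>b + \<rho>\<^sub>b * \<rho>\<^sub>c + \<rho>\<^sub>c * \<rho>\<^sub>a) = r\<^sup>2 * t\<^sup>2"
proof -
  obtain I where I: "incircle I r A B C"
    using assms(2) unfolding is_inradius_def incircle_def by blast
  have nd: "nondegenerate_triangle B C A" "nondegenerate_triangle C A B"
    using assms(1) nondegenerate_triangle_cyclic by blast+
  have ic: "incircle I r B C A" "incircle I r C A B"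
    using I incircle_cyclic by blast+
  define x y z where "x = tangent_length I r A" and "y = tangent_length I r B" and "z = tangent_length I r C"
  have xyz: "0 < x" "0 < y" "0 < z" "r\<^sup>2 * (x + y + z) = x * y * z"
    using sum_tangent_lengths[OF assms(1) I] by (simp_all add: x_def y_def z_def)
  have \<rho>: "r - \<rho>\<^sub>a = t * r\<^sup>2 / x" "r - \<rho>\<^sub>b = t * r\<^sup>2 / y" "r - \<rho>\<^sub>c = t * r\<^sup>2 / z"
    using triad_radius_eq[OF assms(1) I assms(3,4,9)] triad_radius_eq[OF nd(1) ic(1) assms(3,4,10)]
      triad_radius_eq[OF nd(2) ic(2) assms(3,4,11)]
    by (simp_all add: x_def y_def z_def assms(5))
  have "3 * r\<^sup>2 - 2 * r * (\<rho>\<^sub>a + \<rho>\<^sub>b + \<rho>\<^sub>c) + (\<rho>\<^sub>a * \<rho>\<^sub>b + \<rho>\<^sub>b * \<rho>\<^sub>c + \<rho>\<^sub>c * \<rho>\<^sub>a)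
      = (r - \<rho>\<^sub>a) * (r - \<rho>\<^sub>b) + (r - \<rho>\<^sub>b) * (r - \<rho>\<^sub>c) + (r - \<rho>\<^sub>c) * (r - \<rho>\<^sub>a)"
    by algebra
  also have "\<dots> = t\<^sup>2 * r\<^sup>2 * (r\<^sup>2 * (x + y + z)) / (x * y * z)"
    unfolding \<rho> using xyz(1-3) by (simp add: field_simps power2_eq_square)
  also have "\<dots> = r\<^sup>2 * t\<^sup>2" unfolding xyz(4) using xyz(1-3) by simp
  finally show ?thesis .
qed

end
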